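(* Let $S=\{a,b,c\}$ be a three-point metric space with metric $d$ satisfying $d(a,b)<d(a,c)<d(b,c)$. Then there is no $\pi_{1,2}$-invariant probability distribution on $S$ except the omnipresent ones; that is, every $\theta\in\mathcal P(S)$ with $\pi_{1,2}(\theta)=\theta$ is either of the form $\delta_s$ with $s\in S$ or of the form $\delta_{s_1,s_2}=\frac12(\delta_{s_1}+\delta_{s_2})$ with $s_1,s_2\in S$ distinct.
   Context: $\mathcal P(S)$ is the set of Borel probability measures on a compact metric space $(S,d)$. Given $\theta\in\mathcal P(S)$ and integers $k\ge 2$, $1\le j\le k$, consider the Markov chain on $S$ which from state $s$ draws $k$ i.i.d. samples from $\theta$ and jumps to the $j$'th nearest of them to $s$ (ordering by increasing distance from $s$, ties broken uniformly at random). This chain has a unique stationary distribution, denoted $\pi_{j,k}(\theta)$, which defines a map $\pi_{j,k}:\mathcal P(S)\to\mathcal P(S)$. A distribution $\phi$ is $\pi_{j,k}$-invariant if $\pi_{j,k}(\phi)=\phi$. The omnipresent measures are the point masses $\delta_s$ and the uniform two-point distributions $\delta_{s_1,s_2}=\frac12(\delta_{s_1}+\delta_{s_2})$. *)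

theory Defs
  imports "HOL-Probability.Probability"
begin

text \<open>
  The state space \<open>S\<close> is the whole type \<open>'a\<close>; \<open>\<P>(S)\<close> is \<open>space (prob_algebra borel)\<close>.
  The definitions are intended for compact \<open>S\<close> (so second countable), where all the maps
  passed to the Giry monad are measurable.
\<close>

text \<open>
  All ways to list the samples \<open>x 1, \<dots>, x k\<close> by increasing distance from \<open>s\<close>: there is more
  than one exactly if there are ties. Breaking ties uniformly at random means choosing one of
  these listings uniformly.
\<close>

definition sorting_perms :: "nat \<Rightarrow> 'a::metric_space \<Rightarrow> (nat \<Rightarrow> 'a) \<Rightarrow> (nat \<Rightarrow> nat) set" where
  "sorting_perms k s x =
     {\<sigma>. \<sigma> permutes {1..k} \<and> mono_on {1..k} (\<lambda>i. dist s (x (\<sigma> i)))}"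

definition jth_nearest :: "nat \<Rightarrow> nat \<Rightarrow> 'a::metric_space \<Rightarrow> (nat \<Rightarrow> 'a) \<Rightarrow> 'a measure" where
  "jth_nearest j k s x =
     distr (measure_pmf (pmf_of_set (sorting_perms k s x))) borel (\<lambda>\<sigma>. x (\<sigma> j))"

definition jump_kernel :: "nat \<Rightarrow> nat \<Rightarrow> 'a::metric_space measure \<Rightarrow> 'a \<Rightarrow> 'a measure" where
  "jump_kernel j k \<theta> s = (\<Pi>\<^sub>M i\<in>{1..k}. \<theta>) \<bind> jth_nearest j k s"

definition stationary :: "('a::metric_space \<Rightarrow> 'a measure) \<Rightarrow> 'a measure \<Rightarrow> bool" where
  "stationary K \<mu> \<longleftrightarrow> \<mu> \<in> space (prob_algebra borel) \<and> \<mu> \<bind> K = \<mu>"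

text \<open>The map \<open>\<pi>\<^sub>j\<^sub>,\<^sub>k\<close>, meant for \<open>k \<ge> 2\<close> and \<open>1 \<le> j \<le> k\<close>.\<close>

definition stat_map :: "nat \<Rightarrow> nat \<Rightarrow> 'a::metric_space measure \<Rightarrow> 'a measure" where
  "stat_map j k \<theta> = (THE \<mu>. stationary (jump_kernel j k \<theta>) \<mu>)"

definition pi_invariant :: "nat \<Rightarrow> nat \<Rightarrow> 'a::metric_space measure \<Rightarrow> bool" where
  "pi_invariant j k \<phi> \<longleftrightarrow> \<phi> \<in> space (prob_algebra borel) \<and> stat_map j k \<phi> = \<phi>"

definition point_mass :: "'a::metric_space \<Rightarrow> 'a measure" where
  "point_mass s = return borel s"

definition two_point :: "'a::metric_space \<Rightarrow> 'a \<Rightarrow> 'a measure" where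
  "two_point s\<^sub>1 s\<^sub>2 =
     measure_of UNIV (sets borel)
       (\<lambda>A. (emeasure (point_mass s\<^sub>1) A + emeasure (point_mass s\<^sub>2) A) / 2)"

end

theory Submission
  imports Defs
begin

text \<open>
  Write \<open>p, q, r\<close> for the weights of \<open>\<theta>\<close> at \<open>a, b, c\<close>. The nearer of two samples lies at
  distance at least \<open>\<rho>\<close> from \<open>s\<close> exactly if both samples do, so the chain jumps from \<open>s\<close> into a
  set of the form \<open>{y. \<rho> \<le> dist s y}\<close> with probability \<open>\<theta>{y. \<rho> \<le> dist s y}\<^sup>2\<close>
  (\<open>measure_jump_kernel_far\<close>). These sets determine the whole transition matrix, and the
  inequalities between the three distances fix its form: \<open>a\<close> prefers \<open>b\<close> to \<open>c\<close>, while \<open>b\<close> and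
  \<open>c\<close> both prefer \<open>a\<close> to the other.

  Invariance speaks of the unique stationary distribution, and turns into balance equations for
  \<open>\<theta>\<close> only once existence and uniqueness are known. Two equal samples may be drawn from any atom
  of \<open>\<theta>\<close>, so this atom is reached in one step from every state; a three-state chain with such a
  state has exactly one stationary distribution, given by the Markov chain tree formula
  (\<open>ex1_stationary_three_states\<close>).

  The balance equations are then polynomial equations in \<open>p, q, r\<close>, which together with
  \<open>p, q, r \<ge> 0\<close> and \<open>p + q + r = 1\<close> have only the six omnipresent solutions (\<open>balance_solutions\<close>).
\<close>

section \<open>Borel probability measures on a finite metric space\<close>

lemma sets_borel_finite:
  assumes "finite (UNIV :: 'a::metric_space set)"
  shows "sets (borel :: 'a measure) = UNIV"
proof -
  have "A \<in> sets borel" for A :: "'a set"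
    using assms by (intro borel_closed finite_imp_closed) (rule finite_subset[OF subset_UNIV])
  then show ?thesis by auto
qed

text \<open>
  All subsets of a finite space are Borel, so no kernel on it can fail to be measurable; this
  is what makes the Giry bind computable below.
\<close>

lemma measurable_kernel_finite:
  fixes K :: "'a::metric_space \<Rightarrow> 'a measure"
  assumes fin: "finite (UNIV :: 'a set)" and K: "\<And>s. K s \<in> space (prob_algebra borel)"
  shows "K \<in> borel \<rightarrow>\<^sub>M prob_algebra borel"
proof -
  have "sets (borel :: 'a measure) = sets (count_space UNIV)"
    by (simp add: sets_borel_finite[OF fin])
  then have "measurable (borel :: 'a measure) (prob_algebra (borel :: 'a measure))
      = measurable (count_space UNIV) (prob_algebra borel)"
    by (rule measurable_cong_sets) simp
  then show ?thesis using K by simp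
qed

lemma prob_eqI_singletons:
  fixes \<mu> \<nu> :: "'a::metric_space measure"
  assumes fin: "finite (UNIV :: 'a set)"
    and \<mu>: "\<mu> \<in> space (prob_algebra borel)" and \<nu>: "\<nu> \<in> space (prob_algebra borel)"
    and eq: "\<And>t. measure \<mu> {t} = measure \<nu> {t}"
  shows "\<mu> = \<nu>"
proof (rule measure_eqI_finite[of _ UNIV])
  show "sets \<mu> = Pow UNIV" "sets \<nu> = Pow UNIV"
    using \<mu> \<nu> by (simp_all add: space_prob_algebra sets_borel_finite[OF fin])
  interpret \<mu>: prob_space \<mu> using \<mu> by (simp add: space_prob_algebra)
  interpret \<nu>: prob_space \<nu> using \<nu> by (simp add: space_prob_algebra)
  show "emeasure \<mu> {t} = emeasure \<nu> {t}" for t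
    by (simp add: \<mu>.emeasure_eq_measure \<nu>.emeasure_eq_measure eq)
qed (rule fin)

lemma measure_eq_sum_finite:
  fixes \<mu> :: "'a::metric_space measure"
  assumes fin: "finite (UNIV :: 'a set)" and \<mu>: "\<mu> \<in> space (prob_algebra borel)"
  shows "measure \<mu> A = (\<Sum>s\<in>A. measure \<mu> {s})"
proof -
  interpret prob_space \<mu> using \<mu> by (simp add: space_prob_algebra)
  show ?thesis
    using \<mu> by (intro finite_measure_eq_sum_singleton finite_subset[OF subset_UNIV fin])
      (simp add: space_prob_algebra sets_borel_finite[OF fin])
qed

lemma sum_measure_UNIV:
  fixes \<mu> :: "'a::metric_space measure"
  assumes fin: "finite (UNIV :: 'a set)" and \<mu>: "\<mu> \<in> space (prob_algebra borel)"
  shows "(\<Sum>s\<in>UNIV. measure \<mu> {s}) = 1"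
proof -
  interpret prob_space \<mu> using \<mu> by (simp add: space_prob_algebra)
  have "space \<mu> = UNIV"
    using \<mu> sets_eq_imp_space_eq[of \<mu> borel] by (simp add: space_prob_algebra)
  then show ?thesis
    using measure_eq_sum_finite[OF assms, of UNIV] prob_space by simp
qed

lemma ex_prob_with_weights:
  fixes w :: "'a::metric_space \<Rightarrow> real"
  assumes fin: "finite (UNIV :: 'a set)"
    and nonneg: "\<And>s. 0 \<le> w s" and total: "(\<Sum>s\<in>UNIV. w s) = 1"
  shows "\<exists>\<mu> \<in> space (prob_algebra borel). \<forall>s. measure \<mu> {s} = w s"
proof (intro bexI allI)
  let ?\<mu> = "point_measure UNIV (\<lambda>s. ennreal (w s))"
  show "measure ?\<mu> {s} = w s" for s
    using nonneg[of s]
    by (simp add: measure_def emeasure_point_measure_finite[OF fin])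
  have "emeasure ?\<mu> (space ?\<mu>) = 1"
    using nonneg total
    by (simp add: emeasure_point_measure_finite[OF fin] space_point_measure sum_ennreal)
  then show "?\<mu> \<in> space (prob_algebra borel)"
    by (auto simp: space_prob_algebra sets_point_measure sets_borel_finite[OF fin]
        intro: prob_spaceI)
qed

lemma point_mass_prob: "point_mass s \<in> space (prob_algebra borel)"
  by (simp add: point_mass_def space_prob_algebra prob_space_return)

lemma measure_point_mass_singleton: "measure (point_mass s) {t} = of_bool (s = t)"
  by (simp add: point_mass_def measure_return)

lemma eq_point_massI:
  fixes \<mu> :: "'a::metric_space measure"
  assumes fin: "finite (UNIV :: 'a set)" and \<mu>: "\<mu> \<in> space (prob_algebra borel)"
    and s: "measure \<mu> {s} = 1"
  shows "\<mu> = point_mass s"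
proof (rule prob_eqI_singletons[OF fin \<mu> point_mass_prob])
  fix t
  interpret prob_space \<mu> using \<mu> by (simp add: space_prob_algebra)
  have "measure \<mu> {t} = 0" if "t \<noteq> s"
    using measure_eq_sum_finite[OF fin \<mu>, of "{s, t}"] prob_le_1[of "{s, t}"] that s
      measure_nonneg[of \<mu> "{t}"] by simp
  then show "measure \<mu> {t} = measure (point_mass s) {t}"
    using s by (auto simp: measure_point_mass_singleton)
qed

text \<open>
  The two-point distribution is given by a set function on the Borel sets. Every measure is
  recovered from its own set function, so it is enough that the two set functions agree.
\<close>

lemma eq_two_pointI:
  fixes \<mu> :: "'a::metric_space measure"
  assumes fin: "finite (UNIV :: 'a set)" and \<mu>: "\<mu> \<in> space (prob_algebra borel)"
    and "s \<noteq> t" and s: "measure \<mu> {s} = 1 / 2" and t: "measure \<mu> {t} = 1 / 2"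
  shows "\<mu> = two_point s t"
proof -
  interpret prob_space \<mu> using \<mu> by (simp add: space_prob_algebra)
  have space: "space \<mu> = UNIV" and sets: "sets \<mu> = sets borel"
    using \<mu> sets_eq_imp_space_eq[of \<mu> borel] by (simp_all add: space_prob_algebra)
  have rest: "measure \<mu> {u} = 0" if "u \<noteq> s" "u \<noteq> t" for u
    using measure_eq_sum_finite[OF fin \<mu>, of "{s, t, u}"] prob_le_1[of "{s, t, u}"] that s t
      \<open>s \<noteq> t\<close> measure_nonneg[of \<mu> "{u}"] by simp
  have "emeasure \<mu> A = (emeasure (point_mass s) A + emeasure (point_mass t) A) / 2" for A
  proof -
    have "measure \<mu> A = (\<Sum>u\<in>A. (of_bool (s = u) + of_bool (t = u)) / 2)"
      unfolding measure_eq_sum_finite[OF fin \<mu>, of A]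
      using \<open>s \<noteq> t\<close> s t rest by (intro sum.cong refl) (auto simp: of_bool_def)
    also have "\<dots> = (indicator A s + indicator A t) / 2"
      using finite_subset[OF subset_UNIV fin, of A]
      by (simp add: sum_divide_distrib[symmetric] sum.distrib of_bool_def indicator_def)
    finally have "emeasure \<mu> A = ennreal ((indicator A s + indicator A t) / 2)"
      by (simp add: emeasure_eq_measure)
    also have "\<dots> = (indicator A s + indicator A t) / 2"
      by (simp add: ennreal_indicator flip: ennreal_divide_numeral)
    finally show ?thesis
      by (simp add: point_mass_def sets_borel_finite[OF fin])
  qed
  then have "two_point s t = measure_of UNIV (sets borel) (emeasure \<mu>)"
    unfolding two_point_def by (intro measure_of_eq) auto
  also have "\<dots> = \<mu>"
    using measure_of_of_measure[of \<mu>] by (simp add: space sets)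
  finally show ?thesis by simp
qed


section \<open>Stationary distributions of a three-state chain\<close>

lemma stationary_iff_balance:
  fixes K :: "'a::metric_space \<Rightarrow> 'a measure"
  assumes fin: "finite (UNIV :: 'a set)" and K: "\<And>s. K s \<in> space (prob_algebra borel)"
    and \<mu>: "\<mu> \<in> space (prob_algebra borel)"
  shows "stationary K \<mu> \<longleftrightarrow>
    (\<forall>t. measure \<mu> {t} = (\<Sum>s\<in>UNIV. measure \<mu> {s} * measure (K s) {t}))"
proof -
  interpret prob_space \<mu> using \<mu> by (simp add: space_prob_algebra)
  have sets: "sets \<mu> = sets borel" and space: "space \<mu> = UNIV"
    using \<mu> sets_eq_imp_space_eq[of \<mu> borel] by (simp_all add: space_prob_algebra)
  have meas: "K \<in> borel \<rightarrow>\<^sub>M prob_algebra borel"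
    by (rule measurable_kernel_finite[OF fin K])
  then have meas': "K \<in> \<mu> \<rightarrow>\<^sub>M subprob_algebra borel"
    by (simp add: measurable_prob_algebraD measurable_cong_sets[OF sets refl])
  have step: "measure (\<mu> \<bind> K) {t} = (\<Sum>s\<in>UNIV. measure \<mu> {s} * measure (K s) {t})" for t
  proof -
    have "measure (\<mu> \<bind> K) {t} = (\<integral>s. measure (K s) {t} \<partial>\<mu>)"
      by (rule measure_bind[OF meas']) simp
    also have "\<dots> = (\<integral>s. (\<Sum>u\<in>UNIV. indicator {u} s * measure (K u) {t}) \<partial>\<mu>)"
      by (intro Bochner_Integration.integral_cong refl)
        (simp add: indicator_def fin if_distrib[of "\<lambda>x. x * _"] cong: if_cong)
    also have "\<dots> = (\<Sum>u\<in>UNIV. measure \<mu> {u} * measure (K u) {t})"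
      by (subst Bochner_Integration.integral_sum)
        (simp_all add: sets space sets_borel_finite[OF fin] less_top[symmetric])
    finally show ?thesis .
  qed
  have "\<mu> \<bind> K \<in> space (prob_algebra borel)"
    using prob_space_bind'[OF \<mu> meas] sets_bind'[OF \<mu> meas] by (simp add: space_prob_algebra)
  then have "\<mu> \<bind> K = \<mu> \<longleftrightarrow> (\<forall>t. measure \<mu> {t} = measure (\<mu> \<bind> K) {t})"
    using prob_eqI_singletons[OF fin _ \<mu>, of "\<mu> \<bind> K"] by auto
  then show ?thesis by (simp add: stationary_def \<mu> step)
qed

lemma UNIV3_sum:
  fixes f :: "'a \<Rightarrow> real"
  assumes "(UNIV :: 'a set) = {a, b, c}" "distinct [a, b, c]"
  shows "(\<Sum>s\<in>UNIV. f s) = f a + f b + f c"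
  unfolding assms(1) using assms(2) by (simp add: add.assoc)

text \<open>
  The Markov chain tree formula on three states: the stationary weight of a state is
  proportional to the sum, over the spanning trees directed towards it, of the products of the
  transition probabilities along the edges. One of these trees consists of the two edges that
  lead straight into the root. If every state reaches the root in one step, this tree has a
  positive product, and the normalising constant \<open>D\<close> does not vanish.
\<close>

lemma ex1_stationary_three_states:
  fixes K :: "'a::metric_space \<Rightarrow> 'a measure"
  assumes U: "(UNIV :: 'a set) = {a, b, c}" and dist: "distinct [a, b, c]"
    and K: "\<And>s. K s \<in> space (prob_algebra borel)"
    and reach: "\<And>s. measure (K s) {t} > 0"
  shows "\<exists>!\<mu>. stationary K \<mu>"
proof -
  have fin: "finite (UNIV :: 'a set)" by (simp add: U)
  note sum3 = UNIV3_sum[OF U dist]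
  define k where "k s u = measure (K s) {u}" for s u
  have k_nonneg: "0 \<le> k s u" for s u by (simp add: k_def)
  have k_sum: "k s a + k s b + k s c = 1" for s
    using sum_measure_UNIV[OF fin K[of s]] by (simp only: sum3 k_def)
  have all3: "(\<forall>s. P s) \<longleftrightarrow> P a \<and> P b \<and> P c" for P :: "'a \<Rightarrow> bool"
    by (metis U UNIV_I insertE singletonD)
  \<comment> \<open>The three spanning trees of \<open>{x, y, z}\<close> directed towards \<open>x\<close>.\<close>
  define T where "T x y z = k y x * k z x + k y x * k z y + k y z * k z x" for x y z
  define D where "D = T a b c + T b a c + T c a b"
  have T_nonneg: "0 \<le> T x y z" for x y z
    by (simp add: T_def k_nonneg)
  have "0 < T x y z" if "x = t" for x y z
    using reach k_nonneg by (auto simp: T_def that k_def intro!: add_pos_nonneg)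
  moreover have "t = a \<or> t = b \<or> t = c" using U by blast
  ultimately have D_pos: "0 < D"
    using T_nonneg by (auto simp: D_def add_pos_nonneg add_nonneg_pos)
  have diag: "k a a = 1 - k a b - k a c" "k b b = 1 - k b a - k b c" "k c c = 1 - k c a - k c b"
    using k_sum[of a] k_sum[of b] k_sum[of c] by linarith+

  have stat: "stationary K \<mu> \<longleftrightarrow>
      measure \<mu> {a} = T a b c / D \<and> measure \<mu> {b} = T b a c / D \<and> measure \<mu> {c} = T c a b / D"
    if \<mu>: "\<mu> \<in> space (prob_algebra borel)" for \<mu>
  proof -
    define x y z where "x = measure \<mu> {a}" and "y = measure \<mu> {b}" and "z = measure \<mu> {c}"
    have total: "x + y + z = 1"
      using sum_measure_UNIV[OF fin \<mu>] by (simp only: sum3 x_def y_def z_def)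
    have "stationary K \<mu> \<longleftrightarrow>
        x = x * k a a + y * k b a + z * k c a \<and>
        y = x * k a b + y * k b b + z * k c b \<and>
        z = x * k a c + y * k b c + z * k c c"
      unfolding stationary_iff_balance[OF fin K \<mu>] all3 sum3 x_def y_def z_def k_def ..
    also have "\<dots> \<longleftrightarrow> x * D = T a b c \<and> y * D = T b a c \<and> z * D = T c a b"
    proof
      assume bal: "x = x * k a a + y * k b a + z * k c a \<and>
        y = x * k a b + y * k b b + z * k c b \<and>
        z = x * k a c + y * k b c + z * k c c"
      \<comment> \<open>The mass flowing out of a state equals the mass flowing in.\<close>
      have 1: "x * (k a b + k a c) = y * k b a + z * k c a"
        and 2: "y * (k b a + k b c) = x * k a b + z * k c b"
        and 3: "z * (k c a + k c b) = x * k a c + y * k b c"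
        using bal unfolding diag by (simp_all add: algebra_simps)
      show "x * D = T a b c \<and> y * D = T b a c \<and> z * D = T c a b"
        using 1 2 3 total unfolding D_def T_def by algebra
    next
      assume "x * D = T a b c \<and> y * D = T b a c \<and> z * D = T c a b"
      then have xyz: "x = T a b c / D" "y = T b a c / D" "z = T c a b / D"
        using D_pos by (simp_all add: field_simps)
      show "x = x * k a a + y * k b a + z * k c a \<and>
        y = x * k a b + y * k b b + z * k c b \<and>
        z = x * k a c + y * k b c + z * k c c"
        unfolding xyz diag using D_pos
        by (simp add: field_simps) (simp add: T_def algebra_simps)
    qed
    also have "\<dots> \<longleftrightarrow> x = T a b c / D \<and> y = T b a c / D \<and> z = T c a b / D"
      using D_pos by (simp add: field_simps)
    finally show ?thesis by (simp add: x_def y_def z_def)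
  qed

  define w where "w s = (if s = a then T a b c else if s = b then T b a c else T c a b) / D" for s
  have ne: "b \<noteq> a" "c \<noteq> a" "c \<noteq> b" using dist by auto
  have "(\<Sum>s\<in>UNIV. w s) = 1"
    unfolding sum3 using D_pos by (simp add: w_def ne add_divide_distrib[symmetric] D_def)
  moreover have "0 \<le> w s" for s
    using T_nonneg D_pos by (simp add: w_def)
  ultimately obtain \<mu> where \<mu>: "\<mu> \<in> space (prob_algebra borel)" and w: "\<And>s. measure \<mu> {s} = w s"
    using ex_prob_with_weights[OF fin, of w] by auto
  show ?thesis
  proof (rule ex1I)
    show "stationary K \<mu>"
      unfolding stat[OF \<mu>] w by (simp add: w_def ne)
    fix \<nu> assume \<nu>: "stationary K \<nu>"
    then have \<nu>': "\<nu> \<in> space (prob_algebra borel)" by (simp add: stationary_def)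
    have "\<forall>s. measure \<nu> {s} = measure \<mu> {s}"
      using \<nu> unfolding stat[OF \<nu>'] w all3 by (simp add: w_def ne)
    then show "\<nu> = \<mu>" by (intro prob_eqI_singletons[OF fin \<nu>' \<mu>]) simp
  qed
qed


section \<open>Jumping to the nearer of two samples\<close>

lemma sorting_perms_two_nonempty: "sorting_perms 2 s x \<noteq> {}"
proof -
  have I: "{1..2} = {1, 2 :: nat}" by auto
  show ?thesis
  proof (cases "dist s (x 1) \<le> dist s (x 2)")
    case True
    then have "id \<in> sorting_perms 2 s x"
      by (auto simp: sorting_perms_def I mono_on_def
          simp del: One_nat_def)
    then show ?thesis by blast
  next
    case False
    then have "Transposition.transpose 1 2 \<in> sorting_perms 2 s x"
      by (auto simp: sorting_perms_def I mono_on_def simp del: One_nat_def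
          intro!: permutes_swap_id)
    then show ?thesis by blast
  qed
qed

text \<open>
  However a tie is broken, the chosen sample realises the smaller of the two distances. So it
  lies at distance at least \<open>r\<close> precisely if both samples do.
\<close>

lemma measure_nearest_of_two:
  fixes s :: "'a::metric_space"
  assumes A: "{y. r \<le> dist s y} \<in> sets borel"
  shows "measure (jth_nearest 1 2 s x) {y. r \<le> dist s y} =
    of_bool (r \<le> dist s (x 1) \<and> r \<le> dist s (x 2))"
proof -
  let ?S = "sorting_perms 2 s x"
  let ?p = "measure_pmf (pmf_of_set ?S)"
  have fin: "finite ?S"
    by (rule finite_subset[OF _ finite_permutations[of "{1..2}"]]) (auto simp: sorting_perms_def)
  have first: "r \<le> dist s (x (\<sigma> 1)) \<longleftrightarrow> r \<le> dist s (x 1) \<and> r \<le> dist s (x 2)"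
    if \<sigma>: "\<sigma> \<in> ?S" for \<sigma>
  proof -
    have "\<sigma> permutes {1..2}" and mono: "dist s (x (\<sigma> 1)) \<le> dist s (x (\<sigma> 2))"
      using \<sigma> by (auto simp: sorting_perms_def mono_on_def)
    then have "\<sigma> ` {1..2} = {1..2}" by (simp add: permutes_image)
    moreover have "{1..2} = {1, 2 :: nat}" by auto
    ultimately have "{\<sigma> 1, \<sigma> 2} = {1, 2}" by simp
    then show ?thesis using mono by (auto simp: doubleton_eq_iff)
  qed
  have "measure (jth_nearest 1 2 s x) {y. r \<le> dist s y} = measure ?p {\<sigma>. r \<le> dist s (x (\<sigma> 1))}"
    unfolding jth_nearest_def using A by (subst measure_distr) (auto simp: vimage_def)
  also have "\<dots> = measure ?p {\<sigma>. r \<le> dist s (x 1) \<and> r \<le> dist s (x 2)}"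
    by (rule measure_pmf.finite_measure_eq_AE)
      (auto simp: AE_measure_pmf_iff set_pmf_of_set[OF sorting_perms_two_nonempty fin] first
        simp del: One_nat_def)
  also have "\<dots> = of_bool (r \<le> dist s (x 1) \<and> r \<le> dist s (x 2))"
    using measure_pmf.prob_space[of "pmf_of_set ?S"] by auto
  finally show ?thesis .
qed

lemma jth_nearest_prob: "jth_nearest j k s x \<in> space (prob_algebra borel)"
  by (auto simp: jth_nearest_def space_prob_algebra intro!: measure_pmf.prob_space_distr)

lemma sets_PiM_finite_space:
  fixes \<theta> :: "'a::metric_space measure"
  assumes fin: "finite (UNIV :: 'a set)" and \<theta>: "\<theta> \<in> space (prob_algebra borel)"
    and I: "finite I"
  shows "sets (\<Pi>\<^sub>M i\<in>I. \<theta>) = Pow (I \<rightarrow>\<^sub>E UNIV)"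
proof -
  have "sets (\<Pi>\<^sub>M i\<in>I. \<theta>) = sets (\<Pi>\<^sub>M i\<in>I. count_space UNIV)"
    using \<theta> by (intro sets_PiM_cong) (simp_all add: space_prob_algebra sets_borel_finite[OF fin])
  also have "(\<Pi>\<^sub>M i\<in>I. count_space (UNIV :: 'a set)) = count_space (I \<rightarrow>\<^sub>E UNIV)"
    using fin by (intro count_space_PiM_finite I) (simp add: countable_finite)
  finally show ?thesis by simp
qed

lemma
  fixes \<theta> :: "'a::metric_space measure"
  assumes fin: "finite (UNIV :: 'a set)" and \<theta>: "\<theta> \<in> space (prob_algebra borel)"
  shows samples_prob: "(\<Pi>\<^sub>M i\<in>{1..k}. \<theta>) \<in> space (prob_algebra (\<Pi>\<^sub>M i\<in>{1..k}. \<theta>))"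
    and measurable_jth_nearest:
      "jth_nearest j k s \<in> (\<Pi>\<^sub>M i\<in>{1..k}. \<theta>) \<rightarrow>\<^sub>M prob_algebra borel"
proof -
  interpret prob_space \<theta> using \<theta> by (simp add: space_prob_algebra)
  show "(\<Pi>\<^sub>M i\<in>{1..k}. \<theta>) \<in> space (prob_algebra (\<Pi>\<^sub>M i\<in>{1..k}. \<theta>))"
    by (simp add: space_prob_algebra prob_space_PiM prob_space_axioms)
  have "measurable (\<Pi>\<^sub>M i\<in>{1..k}. \<theta>) (prob_algebra (borel :: 'a measure)) =
      measurable (count_space ({1..k} \<rightarrow>\<^sub>E UNIV)) (prob_algebra borel)"
    by (rule measurable_cong_sets) (simp_all add: sets_PiM_finite_space[OF fin \<theta>])
  then show "jth_nearest j k s \<in> (\<Pi>\<^sub>M i\<in>{1..k}. \<theta>) \<rightarrow>\<^sub>M prob_algebra borel"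
    by (simp only: measurable_count_space_eq1) (intro funcsetI jth_nearest_prob)
qed

lemma jump_kernel_prob:
  fixes \<theta> :: "'a::metric_space measure"
  assumes "finite (UNIV :: 'a set)" and "\<theta> \<in> space (prob_algebra borel)"
  shows "jump_kernel j k \<theta> s \<in> space (prob_algebra borel)"
  unfolding jump_kernel_def
  using prob_space_bind'[OF samples_prob measurable_jth_nearest, OF assms assms]
    sets_bind'[OF samples_prob measurable_jth_nearest, OF assms assms]
  by (simp add: space_prob_algebra)

text \<open>
  The two samples are independent, so the event that both lie in the far set has the square of
  its probability.
\<close>

lemma measure_jump_kernel_far:
  fixes \<theta> :: "'a::metric_space measure"
  assumes fin: "finite (UNIV :: 'a set)" and \<theta>: "\<theta> \<in> space (prob_algebra borel)"
  shows "measure (jump_kernel 1 2 \<theta> s) {y. r \<le> dist s y} = (measure \<theta> {y. r \<le> dist s y})\<^sup>2"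
proof -
  let ?A = "{y. r \<le> dist s y}"
  let ?P = "\<Pi>\<^sub>M i\<in>{1..2::nat}. \<theta>"
  interpret prob_space \<theta> using \<theta> by (simp add: space_prob_algebra)
  interpret P: prob_space ?P by (intro prob_space_PiM prob_space_axioms)
  interpret finite_product_prob_space "\<lambda>_. \<theta>" "{1..2::nat}"
    by unfold_locales simp
  have sets: "sets \<theta> = UNIV" and space: "space \<theta> = UNIV"
    using \<theta> sets_eq_imp_space_eq[of \<theta> borel]
    by (simp_all add: space_prob_algebra sets_borel_finite[OF fin])
  have I: "{1..2} = {1, 2 :: nat}" by auto
  have "measure (jump_kernel 1 2 \<theta> s) ?A = (\<integral>x. measure (jth_nearest 1 2 s x) ?A \<partial>?P)"
    unfolding jump_kernel_def
    by (intro P.measure_bind[where N = borel] measurable_prob_algebraD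
        measurable_jth_nearest[OF fin \<theta>]) (simp add: sets_borel_finite[OF fin])
  also have "\<dots> = (\<integral>x. indicator ({1..2} \<rightarrow>\<^sub>E ?A) x \<partial>?P)"
  proof (intro Bochner_Integration.integral_cong refl)
    fix x assume "x \<in> Sigma_Algebra.space ?P"
    then have "x \<in> {1..2} \<rightarrow>\<^sub>E UNIV" by (simp add: space_PiM space)
    then have "x \<in> {1..2} \<rightarrow>\<^sub>E ?A \<longleftrightarrow> r \<le> dist s (x 1) \<and> r \<le> dist s (x 2)"
      by (auto simp: PiE_iff I simp del: One_nat_def)
    then show "measure (jth_nearest 1 2 s x) ?A = indicator ({1..2} \<rightarrow>\<^sub>E ?A) x"
      by (subst measure_nearest_of_two) (simp_all add: sets_borel_finite[OF fin] indicator_def)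
  qed
  also have "\<dots> = measure ?P ({1..2} \<rightarrow>\<^sub>E ?A)"
    by (simp add: space_PiM space Int_absorb2 PiE_mono)
  also have "\<dots> = (\<Prod>i\<in>{1..2::nat}. measure \<theta> ?A)"
    by (rule prob_times) (simp add: sets)
  also have "\<dots> = (measure \<theta> ?A)\<^sup>2" by simp
  finally show ?thesis .
qed

text \<open>
  The sets of points at distance at least \<open>r\<close> form a chain, and the preceding lemma gives the
  jump probability into each of them; differences yield the individual states.
\<close>

lemma jump_kernel_three_states:
  fixes \<theta> :: "'a::metric_space measure"
  assumes U: "(UNIV :: 'a set) = {u, v, w}"
    and uv: "u \<noteq> v" and near: "dist u v < dist u w"
    and \<theta>: "\<theta> \<in> space (prob_algebra borel)"
  shows "measure (jump_kernel 1 2 \<theta> u) {w} = (measure \<theta> {w})\<^sup>2"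
    and "measure (jump_kernel 1 2 \<theta> u) {v} =
      measure \<theta> {v} * (measure \<theta> {v} + 2 * measure \<theta> {w})"
    and "measure (jump_kernel 1 2 \<theta> u) {u} =
      measure \<theta> {u} * (measure \<theta> {u} + 2 * (measure \<theta> {v} + measure \<theta> {w}))"
proof -
  have fin: "finite (UNIV :: 'a set)" by (simp add: U)
  have ne: "v \<noteq> w" "u \<noteq> w" using near by auto
  let ?K = "jump_kernel 1 2 \<theta> u"
  have K: "?K \<in> space (prob_algebra borel)" by (rule jump_kernel_prob[OF fin \<theta>])
  have all: "t = u \<or> t = v \<or> t = w" for t using U by blast
  have "dist u w \<le> dist u y \<longleftrightarrow> y = w" for y
    using all[of y] near ne(2) by auto
  then show w: "measure ?K {w} = (measure \<theta> {w})\<^sup>2"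
    using measure_jump_kernel_far[OF fin \<theta>, of u "dist u w"] by simp
  have "dist u v \<le> dist u y \<longleftrightarrow> y \<in> {v, w}" for y
    using all[of y] near uv by auto
  then have "measure ?K {v, w} = (measure \<theta> {v, w})\<^sup>2"
    using measure_jump_kernel_far[OF fin \<theta>, of u "dist u v"]
    by (simp only: Collect_mem_eq)
  then have vw: "measure ?K {v} + measure ?K {w} = (measure \<theta> {v} + measure \<theta> {w})\<^sup>2"
    using ne by (simp add: measure_eq_sum_finite[OF fin K, of "{v, w}"]
        measure_eq_sum_finite[OF fin \<theta>, of "{v, w}"] del: One_nat_def)
  then show "measure ?K {v} = measure \<theta> {v} * (measure \<theta> {v} + 2 * measure \<theta> {w})"
    unfolding w by (simp add: power2_eq_square algebra_simps)
  have sum3: "(\<Sum>s\<in>UNIV. f s) = f u + f v + f w" for f :: "'a \<Rightarrow> real"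
    using U uv ne by (intro UNIV3_sum) auto
  have "measure ?K {u} + measure ?K {v} + measure ?K {w} = 1"
    using sum_measure_UNIV[OF fin K] by (simp only: sum3)
  then have "measure ?K {u} = 1 - (measure \<theta> {v} + measure \<theta> {w})\<^sup>2"
    using vw by linarith
  moreover have "measure \<theta> {u} + measure \<theta> {v} + measure \<theta> {w} = 1"
    using sum_measure_UNIV[OF fin \<theta>] by (simp only: sum3)
  then have "measure \<theta> {u} = 1 - (measure \<theta> {v} + measure \<theta> {w})"
    by linarith
  ultimately show "measure ?K {u} =
      measure \<theta> {u} * (measure \<theta> {u} + 2 * (measure \<theta> {v} + measure \<theta> {w}))"
    by (simp only:) (simp add: power2_eq_square algebra_simps)
qed


section \<open>The invariance equations\<close>

text \<open>
  The state \<open>c\<close> is the less preferred sample at both other states, so its balance equation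
  involves \<open>r\<close> alone, after \<open>p + q = 1 - r\<close> is inserted: it reads \<open>r (1 - r) (1 - 2 r) = 0\<close>. For \<open>r = 0\<close> two states remain, which
  must carry equal or trivial weights. For \<open>r = 1 / 2\<close> the equation for \<open>b\<close> becomes
  \<open>q (2 q - 1)\<^sup>2 = 0\<close>, whose double root excludes an interior solution.
\<close>

lemma balance_solutions:
  fixes p q r :: real
  assumes nonneg: "0 \<le> p" "0 \<le> q" and total: "p + q + r = 1"
    and b: "q = p * (q * (q + 2 * r)) + q * (q * (q + 2 * (p + r))) + r * q\<^sup>2"
    and c: "r = p * r\<^sup>2 + q * r\<^sup>2 + r * (r * (r + 2 * (p + q)))"
  shows "(p, q, r) \<in> {(1, 0, 0), (0, 1, 0), (0, 0, 1), (1/2, 1/2, 0), (1/2, 0, 1/2), (0, 1/2, 1/2)}"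
proof -
  have p: "p = 1 - q - r" using total by simp
  have "r * ((1 - r) * (1 - 2 * r)) = 0" using c unfolding p by algebra
  then consider "r = 0" | "r = 1" | "r = 1 / 2" by auto
  then show ?thesis
  proof cases
    case 1
    have "q * ((1 - q) * (1 - 2 * q)) = 0" using b unfolding p 1 by algebra
    then have "q = 0 \<or> q = 1 \<or> q = 1 / 2" by auto
    then show ?thesis using p 1 by auto
  next
    case 2
    have "q = 0" using nonneg total 2 by linarith
    then show ?thesis using p 2 by auto
  next
    case 3
    have "q * (2 * q - 1)\<^sup>2 = 0" using b unfolding p 3 by (simp add: field_simps power2_eq_square)
    then have "q = 0 \<or> q = 1 / 2" by auto
    then show ?thesis using p 3 by auto
  qed
qed

theorem theorem2:
  fixes a b c :: "'a::metric_space" and \<theta> :: "'a measure"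
  assumes "(UNIV :: 'a set) = {a, b, c}"
    and "distinct [a, b, c]"
    and "dist a b < dist a c"
    and "dist a c < dist b c"
    and "pi_invariant 1 2 \<theta>"
  shows "(\<exists>s. \<theta> = point_mass s) \<or> (\<exists>s\<^sub>1 s\<^sub>2. s\<^sub>1 \<noteq> s\<^sub>2 \<and> \<theta> = two_point s\<^sub>1 s\<^sub>2)"
proof -
  note U = assms(1)
  have fin: "finite (UNIV :: 'a set)" by (simp add: U)
  have ne: "a \<noteq> b" "a \<noteq> c" "b \<noteq> c" using assms(2) by auto
  note sum3 = UNIV3_sum[OF U assms(2)]
  have \<theta>: "\<theta> \<in> space (prob_algebra borel)"
    and fixed: "stat_map 1 2 \<theta> = \<theta>"
    using assms(5) by (simp_all add: pi_invariant_def)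
  let ?K = "jump_kernel 1 2 \<theta>"
  have K: "?K s \<in> space (prob_algebra borel)" for s
    by (rule jump_kernel_prob[OF fin \<theta>])
  define p q r where "p = measure \<theta> {a}" and "q = measure \<theta> {b}" and "r = measure \<theta> {c}"
  have nonneg: "0 \<le> p" "0 \<le> q" "0 \<le> r" by (simp_all add: p_def q_def r_def)
  have total: "p + q + r = 1"
    using sum_measure_UNIV[OF fin \<theta>] by (simp only: sum3 p_def q_def r_def)
  have from_a: "measure (?K a) {c} = r\<^sup>2" "measure (?K a) {b} = q * (q + 2 * r)"
    "measure (?K a) {a} = p * (p + 2 * (q + r))"
    using jump_kernel_three_states[OF U ne(1) assms(3) \<theta>] by (simp_all add: p_def q_def r_def)
  have U_b: "(UNIV :: 'a set) = {b, a, c}" using U by auto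
  have near_b: "dist b a < dist b c" using assms(3,4) by (simp add: dist_commute)
  have from_b: "measure (?K b) {c} = r\<^sup>2" "measure (?K b) {a} = p * (p + 2 * r)"
    "measure (?K b) {b} = q * (q + 2 * (p + r))"
    using jump_kernel_three_states[OF U_b ne(1)[symmetric] near_b \<theta>]
    by (simp_all add: p_def q_def r_def)
  have U_c: "(UNIV :: 'a set) = {c, a, b}" using U by auto
  have near_c: "dist c a < dist c b" using assms(4) by (simp add: dist_commute)
  have from_c: "measure (?K c) {b} = q\<^sup>2" "measure (?K c) {a} = p * (p + 2 * q)"
    "measure (?K c) {c} = r * (r + 2 * (p + q))"
    using jump_kernel_three_states[OF U_c ne(2)[symmetric] near_c \<theta>]
    by (simp_all add: p_def q_def r_def)

  \<comment> \<open>Both samples may be a given atom of \<open>\<theta>\<close>, so that atom is reached from everywhere.\<close>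
  have "\<exists>t. \<forall>s. 0 < measure (?K s) {t}"
  proof -
    have all: "s = a \<or> s = b \<or> s = c" for s using U by blast
    have "0 < measure (?K s) {a}" if "0 < p" for s
      using all[of s] that nonneg
      by (auto simp: from_a from_b from_c simp del: One_nat_def
          intro!: mult_pos_pos add_pos_nonneg)
    moreover have "0 < measure (?K s) {b}" if "0 < q" for s
      using all[of s] that nonneg
      by (auto simp: from_a from_b from_c simp del: One_nat_def
          intro!: mult_pos_pos add_pos_nonneg)
    moreover have "0 < measure (?K s) {c}" if "0 < r" for s
      using all[of s] that nonneg
      by (auto simp: from_a from_b from_c simp del: One_nat_def
          intro!: mult_pos_pos add_pos_nonneg)
    moreover have "0 < p \<or> 0 < q \<or> 0 < r" using total nonneg by linarith
    ultimately show ?thesis by blast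
  qed
  then obtain t where "0 < measure (?K s) {t}" for s by blast
  then have "\<exists>!\<mu>. stationary ?K \<mu>"
    by (rule ex1_stationary_three_states[OF U assms(2) K])
  then have "stationary ?K (stat_map 1 2 \<theta>)"
    unfolding stat_map_def by (rule theI')
  then have "stationary ?K \<theta>"
    unfolding fixed .
  then have bal: "measure \<theta> {t} =
      measure \<theta> {a} * measure (?K a) {t} + measure \<theta> {b} * measure (?K b) {t}
      + measure \<theta> {c} * measure (?K c) {t}" for t
    unfolding stationary_iff_balance[OF fin K \<theta>] sum3 by blast
  have "(p, q, r) \<in> {(1, 0, 0), (0, 1, 0), (0, 0, 1), (1/2, 1/2, 0), (1/2, 0, 1/2), (0, 1/2, 1/2)}"
    using bal[of b] bal[of c] unfolding from_a from_b from_c p_def[symmetric] q_def[symmetric]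
      r_def[symmetric] by (rule balance_solutions[OF nonneg(1,2) total])
  then consider "p = 1" | "q = 1" | "r = 1" | "p = 1/2" "q = 1/2" | "p = 1/2" "r = 1/2"
    | "q = 1/2" "r = 1/2" by auto
  then show ?thesis
    using eq_point_massI[OF fin \<theta>] eq_two_pointI[OF fin \<theta>] ne
    unfolding p_def q_def r_def by cases blast+
qed

end
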